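(* Let $\underline{B}=(B,\leq,0,1,+,C)$ be a contact join-semilattice. Then there is a compact, semiregular, $T_0$ topological space $X$ and an isomorphic embedding $h$ of $\underline{B}$ into the structure $(RC(X),\subseteq,\emptyset,X,\cup,C_X)$, where $RC(X)$ is the set of regular closed subsets of $X$ and $a\,C_X\,b$ iff $a\cap b\neq\emptyset$.
   Context: A subset $a$ of a topological space $X$ is regular closed if it equals the closure of its interior. A contact join-semilattice (CJS) is a structure $(B,\leq,0,1,+,C)$ with $B$ a set, $0,1\in B$, $+$ a binary operation on $B$, and $\leq$, $C$ binary relations on $B$, satisfying for all elements: (1) $x\leq x$; (2) $x\leq y\wedge y\leq x\rightarrow x=y$; (3) $x\leq y\wedge y\leq z\rightarrow x\leq z$; (4) $x+y=y+x$; (5) $x\leq x+y$; (6) $x\leq z\wedge y\leq z\rightarrow x+y\leq z$; (7) $0\leq x$; (8) $x\leq 1$; (9) $xCy\rightarrow x\neq 0$; (10) $xCy\rightarrow yCx$; and, for all integers $m,i,n\geq 1$, the following axioms. (Finite joins are unambiguous since $x+y$ is the least upper bound.) $A^1_{m,i}$: for all $x,y$ and all $s_j^l,t_j^l$ ($1\leq j\leq m$, $1\leq l\leq i$): if $xCy$, and $x\leq s_j^1+\dots+s_j^i$ and $y\leq t_j^1+\dots+t_j^i$ for every $j=1,\dots,m$, then there are $l_1,\dots,l_m,k_1,\dots,k_m\in\{1,\dots,i\}$ such that $s_j^{l_j}Cs_u^{l_u}$ and $t_j^{k_j}Ct_u^{k_u}$ for all $1\leq j\leq u\leq m$, and $s_j^{l_j}Ct_u^{k_u}$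 for all $j,u\in\{1,\dots,m\}$. $A_{n,i}$: for all $t,u$ and all $x_k^j$ ($1\leq k\leq n$, $1\leq j\leq i$): if $t\not\leq u$ and $t\leq x_k^1+\dots+x_k^i$ for every $k$, then there are $j_1,\dots,j_n\in\{1,\dots,i\}$ such that $x_k^{j_k}\not\leq u$ for all $k$ and $x_k^{j_k}Cx_l^{j_l}$ for all $k,l$. An isomorphic embedding of $(B,\leq,0,1,+,C)$ into $(B',\leq',0',1',+',C')$ is an injective map $h$ with $h(0)=0'$, $h(1)=1'$, $h(a+b)=h(a)+'h(b)$, $a\leq b\iff h(a)\leq' h(b)$, and $aCb\iff h(a)C'h(b)$. *)

theory Defs
  imports "HOL-Analysis.Analysis"
begin

record 'a contact_structure =
  elems :: "'a set"
  le :: "'a \<Rightarrow> 'a \<Rightarrow> bool"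
  bottom :: "'a"
  unit :: "'a"
  join :: "'a \<Rightarrow> 'a \<Rightarrow> 'a"
  contact :: "'a \<Rightarrow> 'a \<Rightarrow> bool"

(* f 1 + ... + f i, bracketed to the left; the axioms below use it for i \<ge> 1 only. *)
fun finite_join :: "'a contact_structure \<Rightarrow> (nat \<Rightarrow> 'a) \<Rightarrow> nat \<Rightarrow> 'a" where
  "finite_join B f 0 = bottom B"
| "finite_join B f (Suc 0) = f 1"
| "finite_join B f (Suc (Suc n)) = join B (finite_join B f (Suc n)) (f (Suc (Suc n)))"

(* A family x_k^j is written x k j. *)
definition axiom_A1 :: "'a contact_structure \<Rightarrow> nat \<Rightarrow> nat \<Rightarrow> bool" where
  "axiom_A1 B m i \<longleftrightarrow>
     (\<forall>x\<in>elems B. \<forall>y\<in>elems B. \<forall>s t :: nat \<Rightarrow> nat \<Rightarrow> 'a.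
        (\<forall>j\<in>{1..m}. \<forall>l\<in>{1..i}. s j l \<in> elems B \<and> t j l \<in> elems B) \<longrightarrow>
        contact B x y \<longrightarrow>
        (\<forall>j\<in>{1..m}. le B x (finite_join B (s j) i) \<and> le B y (finite_join B (t j) i)) \<longrightarrow>
        (\<exists>l k :: nat \<Rightarrow> nat.
           (\<forall>j\<in>{1..m}. l j \<in> {1..i} \<and> k j \<in> {1..i}) \<and>
           (\<forall>j\<in>{1..m}. \<forall>u\<in>{1..m}. j \<le> u \<longrightarrow>
              contact B (s j (l j)) (s u (l u)) \<and> contact B (t j (k j)) (t u (k u))) \<and>
           (\<forall>j\<in>{1..m}. \<forall>u\<in>{1..m}. contact B (s j (l j)) (t u (k u)))))"

definition axiom_A :: "'a contact_structure \<Rightarrow> nat \<Rightarrow> nat \<Rightarrow> bool" where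
  "axiom_A B n i \<longleftrightarrow>
     (\<forall>t\<in>elems B. \<forall>u\<in>elems B. \<forall>x :: nat \<Rightarrow> nat \<Rightarrow> 'a.
        (\<forall>k\<in>{1..n}. \<forall>j\<in>{1..i}. x k j \<in> elems B) \<longrightarrow>
        \<not> le B t u \<longrightarrow>
        (\<forall>k\<in>{1..n}. le B t (finite_join B (x k) i)) \<longrightarrow>
        (\<exists>j :: nat \<Rightarrow> nat.
           (\<forall>k\<in>{1..n}. j k \<in> {1..i}) \<and>
           (\<forall>k\<in>{1..n}. \<not> le B (x k (j k)) u) \<and>
           (\<forall>k\<in>{1..n}. \<forall>l\<in>{1..n}. contact B (x k (j k)) (x l (j l)))))"

definition contact_join_semilattice :: "'a contact_structure \<Rightarrow> bool" where
  "contact_join_semilattice B \<longleftrightarrow>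
     bottom B \<in> elems B \<and> unit B \<in> elems B \<and>
     (\<forall>x\<in>elems B. \<forall>y\<in>elems B. join B x y \<in> elems B) \<and>
     (\<forall>x\<in>elems B. le B x x) \<and>
     (\<forall>x\<in>elems B. \<forall>y\<in>elems B. le B x y \<and> le B y x \<longrightarrow> x = y) \<and>
     (\<forall>x\<in>elems B. \<forall>y\<in>elems B. \<forall>z\<in>elems B. le B x y \<and> le B y z \<longrightarrow> le B x z) \<and>
     (\<forall>x\<in>elems B. \<forall>y\<in>elems B. join B x y = join B y x) \<and>
     (\<forall>x\<in>elems B. \<forall>y\<in>elems B. le B x (join B x y)) \<and>
     (\<forall>x\<in>elems B. \<forall>y\<in>elems B. \<forall>z\<in>elems B. le B x z \<and> le B y z \<longrightarrow> le B (join B x y) z) \<and>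
     (\<forall>x\<in>elems B. le B (bottom B) x) \<and>
     (\<forall>x\<in>elems B. le B x (unit B)) \<and>
     (\<forall>x\<in>elems B. \<forall>y\<in>elems B. contact B x y \<longrightarrow> x \<noteq> bottom B) \<and>
     (\<forall>x\<in>elems B. \<forall>y\<in>elems B. contact B x y \<longrightarrow> contact B y x) \<and>
     (\<forall>m\<ge>1. \<forall>i\<ge>1. axiom_A1 B m i) \<and>
     (\<forall>n\<ge>1. \<forall>i\<ge>1. axiom_A B n i)"

definition isomorphic_embedding ::
    "('a \<Rightarrow> 'b) \<Rightarrow> 'a contact_structure \<Rightarrow> 'b contact_structure \<Rightarrow> bool" where
  "isomorphic_embedding h B B' \<longleftrightarrow>
     h ` elems B \<subseteq> elems B' \<and> inj_on h (elems B) \<and>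
     h (bottom B) = bottom B' \<and> h (unit B) = unit B' \<and>
     (\<forall>a\<in>elems B. \<forall>b\<in>elems B. h (join B a b) = join B' (h a) (h b)) \<and>
     (\<forall>a\<in>elems B. \<forall>b\<in>elems B. le B a b \<longleftrightarrow> le B' (h a) (h b)) \<and>
     (\<forall>a\<in>elems B. \<forall>b\<in>elems B. contact B a b \<longleftrightarrow> contact B' (h a) (h b))"

definition regular_closedin :: "'a topology \<Rightarrow> 'a set \<Rightarrow> bool" where
  "regular_closedin X a \<longleftrightarrow> a = X closure_of (X interior_of a)"

definition regular_openin :: "'a topology \<Rightarrow> 'a set \<Rightarrow> bool" where
  "regular_openin X U \<longleftrightarrow> U = X interior_of (X closure_of U)"

(* The regular open sets form a base. *)
definition semiregular_space :: "'a topology \<Rightarrow> bool" where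
  "semiregular_space X \<longleftrightarrow> openin X = arbitrary union_of (regular_openin X)"

lemma regular_openin_complement:
  "regular_openin X (topspace X - a) \<longleftrightarrow> regular_closedin X a" if "a \<subseteq> topspace X"
proof -
  have "X interior_of (X closure_of (topspace X - a)) =
        topspace X - X closure_of (X interior_of a)"
    by (simp add: closure_of_complement interior_of_complement)
  then show ?thesis
    using that closure_of_subset_topspace[of X "X interior_of a"]
    unfolding regular_openin_def regular_closedin_def by auto
qed

lemma semiregular_space_iff:
  "semiregular_space X \<longleftrightarrow>
     (\<forall>U x. openin X U \<and> x \<in> U \<longrightarrow> (\<exists>V. regular_openin X V \<and> x \<in> V \<and> V \<subseteq> U))"
proof -
  have "openin X V" if "regular_openin X V" for V
    using that unfolding regular_openin_def by (metis openin_interior_of)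
  then have "semiregular_space X \<longleftrightarrow>
     (\<forall>V. regular_openin X V \<longrightarrow> openin X V) \<and>
     (\<forall>U x. openin X U \<and> x \<in> U \<longrightarrow> (\<exists>V. regular_openin X V \<and> x \<in> V \<and> V \<subseteq> U))"
    unfolding semiregular_space_def by (subst eq_commute) (simp add: openin_topology_base_unique)
  with \<open>\<And>V. regular_openin X V \<Longrightarrow> openin X V\<close> show ?thesis by blast
qed

(* Equivalently, the regular closed sets form a base for the closed sets. *)
lemma semiregular_space_closed_base:
  "semiregular_space X \<longleftrightarrow>
     (\<forall>F x. closedin X F \<and> x \<in> topspace X - F \<longrightarrow>
        (\<exists>a. regular_closedin X a \<and> F \<subseteq> a \<and> x \<notin> a))"
  unfolding semiregular_space_iff
proof (intro iffI allI impI)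
  fix F x
  assume H: "\<forall>U x. openin X U \<and> x \<in> U \<longrightarrow> (\<exists>V. regular_openin X V \<and> x \<in> V \<and> V \<subseteq> U)"
    and F: "closedin X F \<and> x \<in> topspace X - F"
  then obtain V where V: "regular_openin X V" "x \<in> V" "V \<subseteq> topspace X - F"
    by (meson openin_diff openin_topspace)
  then have "topspace X - (topspace X - V) = V" by blast
  then have "regular_closedin X (topspace X - V)"
    using V(1) regular_openin_complement[of "topspace X - V" X] by simp
  then show "\<exists>a. regular_closedin X a \<and> F \<subseteq> a \<and> x \<notin> a"
    using V F closedin_subset by (intro exI[of _ "topspace X - V"]) blast
next
  fix U x
  assume H: "\<forall>F x. closedin X F \<and> x \<in> topspace X - F \<longrightarrow>
        (\<exists>a. regular_closedin X a \<and> F \<subseteq> a \<and> x \<notin> a)"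
    and U: "openin X U \<and> x \<in> U"
  have "closedin X (topspace X - U) \<and> x \<in> topspace X - (topspace X - U)"
    using U openin_subset by fastforce
  then obtain a where a: "regular_closedin X a" "topspace X - U \<subseteq> a" "x \<notin> a"
    using H by meson
  have "a \<subseteq> topspace X"
    using a(1) unfolding regular_closedin_def by (metis closure_of_subset_topspace)
  then have "regular_openin X (topspace X - a)"
    using a(1) regular_openin_complement by blast
  then show "\<exists>V. regular_openin X V \<and> x \<in> V \<and> V \<subseteq> U"
    using a U openin_subset by (intro exI[of _ "topspace X - a"]) blast
qed

definition RC_structure :: "'a topology \<Rightarrow> 'a set contact_structure" where
  "RC_structure X =
     \<lparr> elems = {a. regular_closedin X a}, le = (\<subseteq>), bottom = {}, unit = topspace X,
       join = (\<union>), contact = (\<lambda>a b. a \<inter> b \<noteq> {}) \<rparr>"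

end

(* The points of X are the clans of B: complements of ideals any two of whose members are in
   contact.  Clans form a closed subset of the Cantor space of all subsets of B, so X is even
   compact Hausdorff with a clopen base, and h(a), the set of clans containing a, is clopen.
   Enough clans exist by compactness of the Cantor space: the axioms A and A1 say that from
   finitely many finite covers of t (or of x and of y, if x and y are in contact)
   one can choose pairwise contacting members, so there is a set S of pairwise contacting
   elements meeting every finite cover.  The complement of the ideal generated by B - S is then a clan that is contained in S
   and contains t (or x and y); for t not below u, all members of S are chosen not below u. *)
theory Submission
  imports Defs
begin

section \<open>The Cantor space of subsets and compactness selection\<close>

text \<open>Tychonoff's theorem for powers of the discrete two-point space.\<close>

lemma compact_UNIV_fun_bool: "compact (UNIV :: ('i \<Rightarrow> bool) set)"
proof -
  have "compact_space (euclidean :: bool topology)"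
    by (simp add: compact_space_def finite_imp_compact)
  then have "compact_space (product_topology (\<lambda>_::'i. euclidean :: bool topology) UNIV)"
    by (simp add: compact_space_product_topology)
  then show ?thesis
    by (simp add: euclidean_product_topology compact_space_def)
qed

lemma clopen_coordinate:
  shows open_coordinate: "open {f :: 'i \<Rightarrow> bool. f a}"
    and closed_coordinate: "closed {f :: 'i \<Rightarrow> bool. f a}"
proof -
  have *: "continuous_on UNIV (\<lambda>f :: 'i \<Rightarrow> bool. f a)"
    by (rule continuous_on_product_coordinates)
  have "{f :: 'i \<Rightarrow> bool. f a} = (\<lambda>f. f a) -` {True}" by auto
  moreover have "open {True}" "closed {True}"
    by (simp_all add: open_discrete)
  ultimately show "open {f :: 'i \<Rightarrow> bool. f a}" "closed {f :: 'i \<Rightarrow> bool. f a}"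
    using open_vimage[OF _ *, of "{True}"] closed_vimage[OF _ *, of "{True}"] by simp_all
qed

text \<open>The basic open boxes are themselves clopen: each side is a subset of the discrete space
  \<open>bool\<close>, hence closed, and products of closed sets are closed.\<close>

lemma clopen_base_fun_bool:
  fixes U :: "('i \<Rightarrow> bool) set"
  assumes "open U" "f \<in> U"
  obtains V where "open V" "closed V" "f \<in> V" "V \<subseteq> U"
proof -
  obtain W where W: "finite {i. W i \<noteq> UNIV}" "\<forall>i. open (W i)"
      "f \<in> Pi\<^sub>E UNIV W" "Pi\<^sub>E UNIV W \<subseteq> U"
  proof -
    have "openin (product_topology (\<lambda>_::'i. euclidean) UNIV) U"
      using assms(1) by (simp add: euclidean_product_topology)
    then show thesis
      using that assms(2) by (auto simp: openin_product_topology_alt)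
  qed
  have "openin (product_topology (\<lambda>i. euclidean) UNIV) (Pi\<^sub>E UNIV W)"
    using W by (subst openin_PiE_gen) auto
  moreover have "closedin (product_topology (\<lambda>i. euclidean) UNIV) (Pi\<^sub>E UNIV W)"
    by (subst closedin_product_topology) (auto simp: finite_imp_closed)
  ultimately show thesis
    using that[of "Pi\<^sub>E UNIV W"] W by (simp add: euclidean_product_topology)
qed

text \<open>A compactness argument on characteristic functions: pairwise compatibility and meeting a
  given finite set are closed conditions, so the finite intersection property of the compact set
  \<open>K\<close> glues solutions for finite subfamilies into one for all of
  \<open>\<F>\<close>.\<close>

lemma compatible_hitting_set:
  fixes R :: "'i \<Rightarrow> 'i \<Rightarrow> bool"
  assumes fin: "\<And>F. F \<in> \<F> \<Longrightarrow> finite F"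
    and hit: "\<And>\<G>. finite \<G> \<Longrightarrow> \<G> \<subseteq> \<F> \<Longrightarrow>
      \<exists>S. (\<forall>a\<in>S. \<forall>b\<in>S. R a b) \<and> (\<forall>F\<in>\<G>. S \<inter> F \<noteq> {})"
  shows "\<exists>S. (\<forall>a\<in>S. \<forall>b\<in>S. R a b) \<and> (\<forall>F\<in>\<F>. S \<inter> F \<noteq> {})"
proof -
  define K where "K = {f :: 'i \<Rightarrow> bool. \<forall>a b. f a \<and> f b \<longrightarrow> R a b}"
  define D where "D F = {f :: 'i \<Rightarrow> bool. \<exists>a\<in>F. f a}" for F
  have "closed K"
    unfolding K_def
    by (intro closed_Collect_all closed_Collect_imp open_Collect_conj open_coordinate
        closed_Collect_const)
  then have "compact K"
    using compact_UNIV_fun_bool closed_Int_compact[of K UNIV] by simp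
  moreover have "closed (D F)" if "F \<in> \<F>" for F
  proof -
    \<comment> \<open>Finiteness of \<open>F\<close> enters here: a finite union of closed
      coordinate sets is closed.\<close>
    have "D F = (\<Union>a\<in>F. {f. f a})"
      by (auto simp: D_def)
    then show ?thesis
      using fin[OF that] by (simp add: closed_UN closed_coordinate)
  qed
  moreover have "K \<inter> \<Inter> \<H> \<noteq> {}" if \<H>: "finite \<H>" "\<H> \<subseteq> D ` \<F>" for \<H>
  proof -
    obtain \<G> where "finite \<G>" "\<G> \<subseteq> \<F>" and \<G>: "\<H> = D ` \<G>"
      using finite_subset_image[OF \<H>] by blast
    then obtain S where "\<forall>a\<in>S. \<forall>b\<in>S. R a b" "\<forall>F\<in>\<G>. S \<inter> F \<noteq> {}"
      using hit by meson
    then have "(\<lambda>a. a \<in> S) \<in> K \<inter> \<Inter> \<H>"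
      unfolding \<G> by (auto simp: K_def D_def)
    then show ?thesis by blast
  qed
  ultimately have "K \<inter> \<Inter> (D ` \<F>) \<noteq> {}"
    by (metis (no_types, lifting) compact_imp_fip imageE)
  then obtain f where "f \<in> K" "\<forall>F\<in>\<F>. f \<in> D F" by blast
  then show ?thesis
    by (intro exI[of _ "{a. f a}"]) (auto simp: K_def D_def)
qed

text \<open>Repetitions are allowed so that sets of different sizes can share one index range, as
  the rectangular families in the axioms require.\<close>

lemma finite_enumeration:
  assumes "finite F" "F \<noteq> {}" "card F \<le> n"
  obtains f :: "nat \<Rightarrow> 'i" where "f ` {1..n} = F"
proof -
  obtain h where h: "bij_betw h {1..card F} F"
    using ex_bij_betw_nat_finite_1[OF assms(1)] by blast
  have c: "card F \<ge> 1"
    using assms by (simp add: Suc_le_eq card_gt_0_iff)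
  \<comment> \<open>Surplus indices repeat \<open>h 1\<close>, which lies in \<open>F\<close> thanks
    to \<open>c\<close>.\<close>
  define f where "f j = (if j \<le> card F then h j else h 1)" for j
  have "f ` {1..n} = h ` {1..card F}"
  proof (intro equalityI subsetI)
    fix a assume "a \<in> f ` {1..n}"
    then show "a \<in> h ` {1..card F}"
      using c by (auto simp: f_def)
  next
    fix a assume "a \<in> h ` {1..card F}"
    then obtain j where "j \<in> {1..card F}" "a = h j" by blast
    then show "a \<in> f ` {1..n}"
      using assms(3) by (intro image_eqI[of _ _ j]) (auto simp: f_def)
  qed
  then show thesis
    using that h by (simp add: bij_betw_def)
qed

(* Says that x is below the join of F, without mentioning the join. *)
definition covers :: "'a contact_structure \<Rightarrow> 'a \<Rightarrow> 'a set \<Rightarrow> bool" where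
  "covers B x F \<longleftrightarrow> finite F \<and> F \<subseteq> elems B \<and>
     (\<forall>z\<in>elems B. (\<forall>b\<in>F. le B b z) \<longrightarrow> le B x z)"

text \<open>The join clause says two things about the complement of \<open>p\<close>: read from left
  to right, it is closed under joins; read from right to left, it is a down-set, since
  \<open>a\<close> \<le> \<open>b\<close> amounts to \<open>join B a b = b\<close>.\<close>

definition clan :: "'a contact_structure \<Rightarrow> 'a set \<Rightarrow> bool" where
  "clan B p \<longleftrightarrow> p \<subseteq> elems B \<and> bottom B \<notin> p \<and> unit B \<in> p \<and>
     (\<forall>a\<in>elems B. \<forall>b\<in>elems B. join B a b \<in> p \<longleftrightarrow> a \<in> p \<or> b \<in> p) \<and>
     (\<forall>a\<in>p. \<forall>b\<in>p. contact B a b)"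

text \<open>Each instance of a clan condition mentions finitely many coordinates and is therefore
  clopen; the quantifiers only intersect such sets.\<close>

lemma closed_clans: "closed {f. clan B (Collect f)}"
proof -
  \<comment> \<open>Everything is recast as implications between coordinate conditions, whose
    premises must be open and conclusions closed; hence \<open>\<longrightarrow> False\<close> for
    the negation and two implications for the equivalence.\<close>
  have eq: "{f. clan B (Collect f)} = {f.
     (\<forall>a. f a \<longrightarrow> a \<in> elems B) \<and> (f (bottom B) \<longrightarrow> False) \<and> f (unit B) \<and>
     (\<forall>a b. a \<in> elems B \<and> b \<in> elems B \<longrightarrow>
        (f (join B a b) \<longrightarrow> f a \<or> f b) \<and> (f a \<or> f b \<longrightarrow> f (join B a b))) \<and>
     (\<forall>a b. f a \<and> f b \<longrightarrow> contact B a b)}"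
    unfolding clan_def by (intro Collect_cong) (simp add: subset_iff; blast)
  show ?thesis
    unfolding eq
    by (intro closed_Collect_all closed_Collect_imp closed_Collect_conj closed_Collect_disj
        open_Collect_conj open_Collect_disj open_coordinate closed_coordinate
        closed_Collect_const open_Collect_const)
qed

section \<open>Order and covers in a fixed contact join-semilattice\<close>

context
  fixes B :: "'a contact_structure"
  assumes cjs: "contact_join_semilattice B"
begin

lemma bottom_in: "bottom B \<in> elems B"
  and unit_in: "unit B \<in> elems B"
  and join_in: "x \<in> elems B \<Longrightarrow> y \<in> elems B \<Longrightarrow> join B x y \<in> elems B"
  and le_refl: "x \<in> elems B \<Longrightarrow> le B x x"
  and bottom_le: "x \<in> elems B \<Longrightarrow> le B (bottom B) x"
  and le_unit: "x \<in> elems B \<Longrightarrow> le B x (unit B)"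
  and le_join1: "x \<in> elems B \<Longrightarrow> y \<in> elems B \<Longrightarrow> le B x (join B x y)"
  using cjs unfolding contact_join_semilattice_def by simp_all

lemma le_antisym: "x \<in> elems B \<Longrightarrow> y \<in> elems B \<Longrightarrow> le B x y \<Longrightarrow> le B y x \<Longrightarrow> x = y"
  using cjs unfolding contact_join_semilattice_def by meson

lemma le_trans:
  "x \<in> elems B \<Longrightarrow> y \<in> elems B \<Longrightarrow> z \<in> elems B \<Longrightarrow> le B x y \<Longrightarrow> le B y z \<Longrightarrow> le B x z"
  using cjs unfolding contact_join_semilattice_def by meson

lemma join_commute: "x \<in> elems B \<Longrightarrow> y \<in> elems B \<Longrightarrow> join B x y = join B y x"
  using cjs unfolding contact_join_semilattice_def by meson

lemma le_join2: "x \<in> elems B \<Longrightarrow> y \<in> elems B \<Longrightarrow> le B y (join B x y)"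
  by (subst join_commute) (simp_all add: le_join1)

lemma join_least:
  "x \<in> elems B \<Longrightarrow> y \<in> elems B \<Longrightarrow> z \<in> elems B \<Longrightarrow> le B x z \<Longrightarrow> le B y z \<Longrightarrow> le B (join B x y) z"
  using cjs unfolding contact_join_semilattice_def by meson

lemma contact_not_bottom:
  "x \<in> elems B \<Longrightarrow> y \<in> elems B \<Longrightarrow> contact B x y \<Longrightarrow> x \<noteq> bottom B"
  using cjs unfolding contact_join_semilattice_def by meson

lemma contact_sym:
  "x \<in> elems B \<Longrightarrow> y \<in> elems B \<Longrightarrow> contact B x y \<Longrightarrow> contact B y x"
  using cjs unfolding contact_join_semilattice_def by meson

lemma axiom_A1: "m \<ge> 1 \<Longrightarrow> i \<ge> 1 \<Longrightarrow> axiom_A1 B m i"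
  and axiom_A: "n \<ge> 1 \<Longrightarrow> i \<ge> 1 \<Longrightarrow> axiom_A B n i"
  using cjs unfolding contact_join_semilattice_def by simp_all

lemma finite_join_upper:
  assumes "f ` {1..Suc n} \<subseteq> elems B"
  shows "finite_join B f (Suc n) \<in> elems B \<and> (\<forall>j\<in>{1..Suc n}. le B (f j) (finite_join B f (Suc n)))"
  using assms
proof (induction n)
  case 0
  then show ?case by (auto simp: le_refl)
next
  case (Suc n)
  have sub: "f ` {1..Suc n} \<subseteq> elems B" and last: "f (Suc (Suc n)) \<in> elems B"
    using Suc.prems by auto
  have IH: "finite_join B f (Suc n) \<in> elems B"
      "\<forall>j\<in>{1..Suc n}. le B (f j) (finite_join B f (Suc n))"
    using Suc.IH[OF sub] by auto
  have in': "finite_join B f (Suc (Suc n)) \<in> elems B"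
    using IH(1) last by (simp add: join_in)
  have "le B (f j) (finite_join B f (Suc (Suc n)))" if j: "j \<in> {1..Suc (Suc n)}" for j
  proof (cases "j = Suc (Suc n)")
    case True
    then show ?thesis using IH(1) last by (simp add: le_join2)
  next
    case False
    then have "j \<in> {1..Suc n}" using j by auto
    moreover have "le B (finite_join B f (Suc n)) (finite_join B f (Suc (Suc n)))"
      using IH(1) last by (simp add: le_join1)
    ultimately show ?thesis
      using le_trans[of "f j" "finite_join B f (Suc n)"] IH in' sub by blast
  qed
  with in' show ?case by blast
qed

text \<open>The finite join is one of the upper bounds over which \<open>covers\<close> quantifies.
  This converts covers into the form in which the axioms take their premises.\<close>

lemma covers_le_finite_join:
  assumes "covers B x (f ` {1..i})" "i \<ge> 1"
  shows "le B x (finite_join B f i)"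
proof -
  obtain n where "i = Suc n" using assms(2) by (cases i) auto
  then show ?thesis
    using finite_join_upper[of f n] assms(1) unfolding covers_def by auto
qed

lemma covers_singleton: "x \<in> elems B \<Longrightarrow> covers B x {x}"
  by (auto simp: covers_def)

text \<open>Every element, in particular the bottom, is an upper bound of the empty set.\<close>

lemma covers_empty: "x \<in> elems B \<Longrightarrow> covers B x {} \<Longrightarrow> x = bottom B"
  using bottom_in bottom_le[of x] le_antisym[of x "bottom B"] le_refl[of "bottom B"]
  by (simp add: covers_def)

text \<open>The clan is the complement of the ideal generated by \<open>elems B - S\<close>. The
  element \<open>x\<close> only witnesses that this ideal is proper; the last clause allows several
  elements to be placed in the same clan.\<close>

lemma clan_of_hitting_set:
  assumes x: "x \<in> elems B"
    and S: "\<forall>a\<in>S. \<forall>b\<in>S. contact B a b"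
    and hit: "\<forall>F. covers B x F \<longrightarrow> S \<inter> F \<noteq> {}"
  shows "\<exists>p. clan B p \<and> p \<subseteq> S \<and>
    (\<forall>y\<in>elems B. (\<forall>F. covers B y F \<longrightarrow> S \<inter> F \<noteq> {}) \<longrightarrow> y \<in> p)"
proof (intro exI conjI)
  \<comment> \<open>A cover disjoint from \<open>S\<close> is a finite subset of
    \<open>elems B - S\<close>, so \<open>I\<close> is the generated ideal.\<close>
  define I where "I = {a \<in> elems B. \<exists>F. covers B a F \<and> S \<inter> F = {}}"
  define p where "p = elems B - I"
  have down: "a \<in> I" if "b \<in> I" "a \<in> elems B" "le B a b" for a b
    using that le_trans[of a b] unfolding I_def covers_def by blast
  have up: "join B a b \<in> I" if ab_I: "a \<in> I" "b \<in> I" for a b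
  proof -
    obtain F G where F: "covers B a F" "S \<inter> F = {}" and G: "covers B b G" "S \<inter> G = {}"
      using ab_I unfolding I_def by blast
    have ab: "a \<in> elems B" "b \<in> elems B" using ab_I unfolding I_def by auto
    have "covers B (join B a b) (F \<union> G)"
      using F(1) G(1) ab join_least[of a b] unfolding covers_def by auto
    then show ?thesis
      using F(2) G(2) ab join_in unfolding I_def by blast
  qed
  have "covers B (bottom B) {}"
    by (simp add: covers_def bottom_le)
  then have "bottom B \<in> I"
    unfolding I_def using bottom_in by blast
  moreover have xp: "x \<in> p"
    using x hit unfolding p_def I_def by blast
  moreover have "unit B \<in> p"
    using xp down le_unit unit_in unfolding p_def by blast
  moreover have "join B a b \<in> p \<longleftrightarrow> a \<in> p \<or> b \<in> p" if "a \<in> elems B" "b \<in> elems B" for a b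
    using that up[of a b] down[of "join B a b"] join_in le_join1 le_join2 unfolding p_def by blast
  \<comment> \<open>An element outside \<open>S\<close> is covered by its own singleton, which
    misses \<open>S\<close>, and so lies in \<open>I\<close>.\<close>
  moreover show pS: "p \<subseteq> S"
    using covers_singleton unfolding p_def I_def by blast
  ultimately show "clan B p"
    using S unfolding clan_def p_def by blast
  show "\<forall>y\<in>elems B. (\<forall>F. covers B y F \<longrightarrow> S \<inter> F \<noteq> {}) \<longrightarrow> y \<in> p"
    unfolding p_def I_def by blast
qed

text \<open>Arranges finitely many covers as the rows of an \<open>m\<close> by \<open>i\<close>
  array, padded by repetition. As \<open>x\<close> is not the bottom, no cover is empty, so every
  row can be filled.\<close>

lemma enumerate_covers:
  assumes fin: "finite \<G>" and \<G>: "\<G> \<noteq> {}" "\<And>F. F \<in> \<G> \<Longrightarrow> covers B x F"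
    and x: "x \<in> elems B" "x \<noteq> bottom B"
    and m: "card \<G> \<le> m" and i: "\<And>F. F \<in> \<G> \<Longrightarrow> card F \<le> i"
  obtains s where "(\<lambda>k. s k ` {1..i}) ` {1..m} = \<G>"
    "\<forall>k\<in>{1..m}. \<forall>j\<in>{1..i}. s k j \<in> elems B"
    "\<forall>k\<in>{1..m}. le B x (finite_join B (s k) i)"
proof -
  obtain G where G: "G ` {1..m} = \<G>"
    using finite_enumeration[OF fin \<G>(1) m] by blast
  have ne: "G k \<noteq> {}" if "k \<in> {1..m}" for k
  proof
    assume "G k = {}"
    then have "covers B x {}" using that G \<G>(2) by force
    then show False using x covers_empty by blast
  qed
  have "\<exists>f. f ` {1..i} = G k" if "k \<in> {1..m}" for k
  proof -
    have "G k \<in> \<G>" using that G by blast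
    then show ?thesis
      using finite_enumeration[of "G k" i] ne[OF that] \<G>(2) i covers_def by metis
  qed
  then obtain s where s: "\<And>k. k \<in> {1..m} \<Longrightarrow> s k ` {1..i} = G k"
    by metis
  have cov: "covers B x (s k ` {1..i})" if "k \<in> {1..m}" for k
    using s[OF that] G \<G>(2) that by blast
  have "i \<ge> 1" if "k \<in> {1..m}" for k
    using ne[OF that] s[OF that] by (cases i) auto
  then have "\<forall>k\<in>{1..m}. le B x (finite_join B (s k) i)"
    using cov covers_le_finite_join by blast
  moreover have "\<forall>k\<in>{1..m}. \<forall>j\<in>{1..i}. s k j \<in> elems B"
    using cov unfolding covers_def by blast
  moreover have "(\<lambda>k. s k ` {1..i}) ` {1..m} = \<G>"
    unfolding G[symmetric] by (rule image_cong[OF refl s])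
  ultimately show thesis using that by blast
qed

lemma card_bound:
  assumes "finite \<G>"
  obtains i :: nat where "i \<ge> 1" "\<And>F. F \<in> \<G> \<Longrightarrow> card F \<le> i"
proof
  \<comment> \<open>The sum dominates each summand; \<open>Suc\<close> secures
    \<open>i \<ge> 1\<close> even if the sum is 0.\<close>
  show "card F \<le> Suc (sum card \<G>)" if "F \<in> \<G>" for F
    using member_le_sum[of F \<G> card] that assms by simp
qed simp

section \<open>Existence of clans from the axioms\<close>

text \<open>\<open>axiom_A\<close> solves the selection problem for finitely many covers of
  \<open>t\<close>, compactness solves it for all of them, and the hitting set yields the
  clan.\<close>

lemma clan_separates:
  assumes t: "t \<in> elems B" and u: "u \<in> elems B" and tu: "\<not> le B t u"
  obtains p where "clan B p" "t \<in> p" "u \<notin> p"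
proof -
  have fin: "finite F" if "F \<in> Collect (covers B t)" for F
    using that by (simp add: covers_def)
  \<comment> \<open>The unary condition of not lying below \<open>u\<close> is folded into the
    binary relation, so that compactness preserves it along with contact.\<close>
  have hit: "\<exists>S. (\<forall>a\<in>S. \<forall>b\<in>S. contact B a b \<and> \<not> le B a u) \<and> (\<forall>F\<in>\<G>. S \<inter> F \<noteq> {})"
    if fin: "finite \<G>" and cov: "\<G> \<subseteq> Collect (covers B t)" for \<G>
  proof (cases "\<G> = {}")
    case True
    then show ?thesis by (intro exI[of _ "{}"]) auto
  next
    case False
    then have n: "card \<G> \<ge> 1"
      using fin by (simp add: Suc_le_eq card_gt_0_iff)
    obtain i where i: "i \<ge> 1" "\<And>F. F \<in> \<G> \<Longrightarrow> card F \<le> i"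
      using card_bound[OF fin] by blast
    have "t \<noteq> bottom B" using tu u bottom_le by blast
    then obtain s where s: "(\<lambda>k. s k ` {1..i}) ` {1..card \<G>} = \<G>"
        "\<forall>k\<in>{1..card \<G>}. \<forall>j\<in>{1..i}. s k j \<in> elems B"
        "\<forall>k\<in>{1..card \<G>}. le B t (finite_join B (s k) i)"
      using enumerate_covers[OF fin False, of t "card \<G>" i] cov t i(2) by blast
    obtain j where j: "\<forall>k\<in>{1..card \<G>}. j k \<in> {1..i}"
        "\<forall>k\<in>{1..card \<G>}. \<not> le B (s k (j k)) u"
        "\<forall>k\<in>{1..card \<G>}. \<forall>l\<in>{1..card \<G>}. contact B (s k (j k)) (s l (j l))"
      using axiom_A[OF n i(1), unfolded axiom_A_def, THEN bspec, OF t, THEN bspec, OF u,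
          THEN spec, of s, THEN mp, OF s(2), THEN mp, OF tu, THEN mp, OF s(3)]
      by (elim exE conjE) (rule that)
    have "(\<lambda>k. s k (j k)) ` {1..card \<G>} \<inter> F \<noteq> {}" if "F \<in> \<G>" for F
    proof -
      have "F \<in> (\<lambda>k. s k ` {1..i}) ` {1..card \<G>}" using that by (simp only: s(1))
      then obtain k where "k \<in> {1..card \<G>}" "F = s k ` {1..i}" by (elim imageE)
      then show ?thesis using j(1) by blast
    qed
    then show ?thesis
      using j(2,3) by (intro exI[of _ "(\<lambda>k. s k (j k)) ` {1..card \<G>}"]) blast
  qed
  have "\<exists>S. (\<forall>a\<in>S. \<forall>b\<in>S. contact B a b \<and> \<not> le B a u) \<and>
      (\<forall>F\<in>Collect (covers B t). S \<inter> F \<noteq> {})"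
    by (rule compatible_hitting_set) (assumption | rule fin hit)+
  then obtain S where S: "\<forall>a\<in>S. \<forall>b\<in>S. contact B a b \<and> \<not> le B a u"
      "\<forall>F\<in>Collect (covers B t). S \<inter> F \<noteq> {}"
    by (elim exE conjE) (rule that)
  then have hitS: "\<forall>a\<in>S. \<forall>b\<in>S. contact B a b" "\<forall>F. covers B t F \<longrightarrow> S \<inter> F \<noteq> {}"
    by simp_all
  obtain p where p: "clan B p" "p \<subseteq> S" "t \<in> p"
    using clan_of_hitting_set[OF t hitS] t hitS(2) by auto
  \<comment> \<open>Members of \<open>p\<close> lie in \<open>S\<close>, hence are not below
    \<open>u\<close>, whereas \<open>u\<close> is.\<close>
  moreover have "u \<notin> p"
    using p(2) S(1) le_refl[OF u] by blast
  ultimately show thesis using that by simp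
qed

text \<open>The same scheme with \<open>axiom_A1\<close>: one set \<open>S\<close> of pairwise
  contacting elements hits the covers of both \<open>x\<close> and \<open>y\<close>, so both
  elements enter the clan it produces.\<close>

lemma clan_of_contact:
  assumes x: "x \<in> elems B" and y: "y \<in> elems B" and xy: "contact B x y"
  obtains p where "clan B p" "x \<in> p" "y \<in> p"
proof -
  have ne: "x \<noteq> bottom B" "y \<noteq> bottom B"
    using contact_not_bottom contact_sym x y xy by blast+
  have fin: "finite F" if "F \<in> {F. covers B x F \<or> covers B y F}" for F
    using that by (auto simp: covers_def)
  have hit: "\<exists>S. (\<forall>a\<in>S. \<forall>b\<in>S. contact B a b) \<and> (\<forall>F\<in>\<G>. S \<inter> F \<noteq> {})"
    if fin: "finite \<G>" and cov: "\<G> \<subseteq> {F. covers B x F \<or> covers B y F}" for \<G>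
  proof -
    \<comment> \<open>Adding the trivial covers \<open>{x}\<close> and \<open>{y}\<close> keeps both
      families nonempty even if \<open>\<G>\<close> covers only one of the two elements.\<close>
    define X where "X = insert {x} {F \<in> \<G>. covers B x F}"
    define Y where "Y = insert {y} {F \<in> \<G>. covers B y F}"
    have finX: "finite X" and finY: "finite Y"
      using fin by (auto simp: X_def Y_def)
    have covX: "\<And>F. F \<in> X \<Longrightarrow> covers B x F" and covY: "\<And>F. F \<in> Y \<Longrightarrow> covers B y F"
      using x y covers_singleton by (auto simp: X_def Y_def)
    \<comment> \<open>The axiom uses the same number of rows for \<open>x\<close> and for
      \<open>y\<close>; the smaller family is padded.\<close>
    define m where "m = Suc (max (card X) (card Y))"
    have m: "m \<ge> 1" "card X \<le> m" "card Y \<le> m" by (auto simp: m_def)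
    obtain i where i: "i \<ge> 1" "\<And>F. F \<in> X \<union> Y \<Longrightarrow> card F \<le> i"
      using card_bound[of "X \<union> Y"] finX finY by blast
    have "X \<noteq> {}" "Y \<noteq> {}" by (auto simp: X_def Y_def)
    obtain s where s: "(\<lambda>k. s k ` {1..i}) ` {1..m} = X"
        "\<forall>k\<in>{1..m}. \<forall>j\<in>{1..i}. s k j \<in> elems B"
        "\<forall>k\<in>{1..m}. le B x (finite_join B (s k) i)"
      using enumerate_covers[OF finX \<open>X \<noteq> {}\<close> covX x ne(1) m(2)] i(2) by blast
    obtain t where t: "(\<lambda>k. t k ` {1..i}) ` {1..m} = Y"
        "\<forall>k\<in>{1..m}. \<forall>j\<in>{1..i}. t k j \<in> elems B"
        "\<forall>k\<in>{1..m}. le B y (finite_join B (t k) i)"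
      using enumerate_covers[OF finY \<open>Y \<noteq> {}\<close> covY y ne(2) m(3)] i(2) by blast
    have st: "\<forall>j\<in>{1..m}. \<forall>l\<in>{1..i}. s j l \<in> elems B \<and> t j l \<in> elems B"
        "\<forall>j\<in>{1..m}. le B x (finite_join B (s j) i) \<and> le B y (finite_join B (t j) i)"
      using s(2,3) t(2,3) by simp_all
    obtain l k where lk: "\<forall>j\<in>{1..m}. l j \<in> {1..i} \<and> k j \<in> {1..i}"
        "\<forall>j\<in>{1..m}. \<forall>u\<in>{1..m}. j \<le> u \<longrightarrow>
           contact B (s j (l j)) (s u (l u)) \<and> contact B (t j (k j)) (t u (k u))"
        "\<forall>j\<in>{1..m}. \<forall>u\<in>{1..m}. contact B (s j (l j)) (t u (k u))"
      using axiom_A1[OF m(1) i(1), unfolded axiom_A1_def, THEN bspec, OF x, THEN bspec, OF y,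
          THEN spec, of s, THEN spec, of t, THEN mp, OF st(1), THEN mp, OF xy, THEN mp, OF st(2)]
      by (elim exE conjE) (rule that)
    define S where "S = (\<lambda>j. s j (l j)) ` {1..m} \<union> (\<lambda>j. t j (k j)) ` {1..m}"
    have in_B: "s j (l j) \<in> elems B" "t j (k j) \<in> elems B" if "j \<in> {1..m}" for j
      using st(1) lk(1) that by simp_all
    \<comment> \<open>The axiom gives these contacts for \<open>j \<le> u\<close> only; symmetry
      supplies the others.\<close>
    have "contact B (s j (l j)) (s u (l u)) \<and> contact B (t j (k j)) (t u (k u))"
      if j: "j \<in> {1..m}" and u: "u \<in> {1..m}" for j u
    proof (cases "j \<le> u")
      case True
      then show ?thesis using lk(2) j u by simp
    next
      case False
      then have "contact B (s u (l u)) (s j (l j))" "contact B (t u (k u)) (t j (k j))"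
        using lk(2) j u by simp_all
      then show ?thesis
        using contact_sym in_B[OF j] in_B[OF u] by simp
    qed
    moreover have "contact B (t u (k u)) (s j (l j))"
      if j: "j \<in> {1..m}" and u: "u \<in> {1..m}" for j u
      by (rule contact_sym[OF in_B(1)[OF j] in_B(2)[OF u]]) (use lk(3) j u in simp)
    ultimately have "\<forall>a\<in>S. \<forall>b\<in>S. contact B a b"
      using lk(3) by (simp add: S_def ball_Un)
    moreover have "S \<inter> F \<noteq> {}" if "F \<in> \<G>" for F
    proof -
      have "F \<in> X \<or> F \<in> Y" using that cov by (auto simp: X_def Y_def)
      then have "F \<in> (\<lambda>j. s j ` {1..i}) ` {1..m} \<or> F \<in> (\<lambda>j. t j ` {1..i}) ` {1..m}"
        by (simp only: s(1) t(1))
      then obtain j where "j \<in> {1..m}" "F = s j ` {1..i} \<or> F = t j ` {1..i}"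
        by (elim disjE imageE) auto
      then show ?thesis using lk(1) unfolding S_def by blast
    qed
    ultimately show ?thesis by blast
  qed
  have "\<exists>S. (\<forall>a\<in>S. \<forall>b\<in>S. contact B a b) \<and>
      (\<forall>F\<in>{F. covers B x F \<or> covers B y F}. S \<inter> F \<noteq> {})"
    by (rule compatible_hitting_set) (assumption | rule fin hit)+
  then obtain S where S: "\<forall>a\<in>S. \<forall>b\<in>S. contact B a b"
      "\<forall>F\<in>{F. covers B x F \<or> covers B y F}. S \<inter> F \<noteq> {}"
    by (elim exE conjE) (rule that)
  then have hitS: "\<forall>F. covers B x F \<longrightarrow> S \<inter> F \<noteq> {}" "\<forall>F. covers B y F \<longrightarrow> S \<inter> F \<noteq> {}"
    by simp_all
  obtain p where "clan B p" "x \<in> p" "y \<in> p"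
    using clan_of_hitting_set[OF x S(1) hitS(1)] x y hitS by auto
  then show thesis using that by simp
qed

text \<open>Clans are up-sets by their join clause, and \<open>clan_separates\<close> refutes any
  failing inequality.\<close>

lemma clan_le_iff:
  assumes "a \<in> elems B" "b \<in> elems B"
  shows "le B a b \<longleftrightarrow> (\<forall>p. clan B p \<longrightarrow> a \<in> p \<longrightarrow> b \<in> p)"
proof
  assume "le B a b"
  then have "join B a b = b"
    using assms by (meson join_in join_least le_antisym le_join2 le_refl)
  then show "\<forall>p. clan B p \<longrightarrow> a \<in> p \<longrightarrow> b \<in> p"
    using assms unfolding clan_def by metis
qed (use clan_separates assms in blast)

lemma clan_contact_iff:
  assumes "a \<in> elems B" "b \<in> elems B"
  shows "contact B a b \<longleftrightarrow> (\<exists>p. clan B p \<and> a \<in> p \<and> b \<in> p)"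
proof
  assume "contact B a b"
  then obtain p where "clan B p" "a \<in> p" "b \<in> p"
    using clan_of_contact[OF assms] by blast
  then show "\<exists>p. clan B p \<and> a \<in> p \<and> b \<in> p" by blast
qed (auto simp: clan_def)

end

(* Only a change of type: the points of mainTheorem2 have type 'b set set set. *)
definition clan_point :: "'a set \<Rightarrow> 'a set set set" where
  "clan_point p = {{p}}"

text \<open>Undoes the two singletons of \<open>clan_point\<close> and passes to the characteristic
  function, a point of the Cantor space.\<close>

definition point_fun :: "'a set set set \<Rightarrow> 'a \<Rightarrow> bool" where
  "point_fun Q a \<longleftrightarrow> a \<in> \<Union> (\<Union> Q)"

section \<open>The space of clans and its topological properties\<close>

text \<open>Since \<open>point_fun\<close> is injective on the wrapped clans, the pullback is a copy
  of the subspace of clans in the Cantor space.\<close>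

definition clan_space :: "'a contact_structure \<Rightarrow> 'a set set set topology" where
  "clan_space B = pullback_topology (clan_point ` Collect (clan B)) point_fun euclidean"

definition clans_with :: "'a contact_structure \<Rightarrow> 'a \<Rightarrow> 'a set set set set" where
  "clans_with B a = clan_point ` {p. clan B p \<and> a \<in> p}"

lemma point_fun_clan_point [simp]: "point_fun (clan_point p) = (\<lambda>a. a \<in> p)"
  by (auto simp: point_fun_def clan_point_def)

lemma clan_point_eq_iff [simp]: "clan_point p = clan_point q \<longleftrightarrow> p = q"
  by (auto simp: clan_point_def)

lemma topspace_clan_space: "topspace (clan_space B) = clan_point ` Collect (clan B)"
  by (simp add: clan_space_def topspace_pullback_topology)

lemma openin_clan_space:
  "open U \<Longrightarrow> openin (clan_space B) (point_fun -` U \<inter> topspace (clan_space B))"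
  unfolding topspace_clan_space
  by (simp add: clan_space_def openin_pullback_topology) blast

lemma closedin_clan_space:
  assumes "closed U"
  shows "closedin (clan_space B) (point_fun -` U \<inter> topspace (clan_space B))"
proof -
  have "topspace (clan_space B) - point_fun -` U \<inter> topspace (clan_space B)
      = point_fun -` (- U) \<inter> topspace (clan_space B)"
    by auto
  then show ?thesis
    using openin_clan_space[OF open_Compl[OF assms], of B] by (simp add: closedin_def)
qed

text \<open>The space is a continuous image of \<open>K\<close>, a closed subset of the compact
  Cantor space.\<close>

lemma compact_clan_space: "compact_space (clan_space B)"
proof -
  define K where "K = {f. clan B (Collect f)}"
  have "compact K"
    using closed_Int_compact[OF closed_clans compact_UNIV_fun_bool] by (simp add: K_def)
  then have "compact_space (top_of_set K)"
    by (simp add: compact_space_subtopology)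
  moreover have "continuous_map (top_of_set K) (clan_space B) (\<lambda>f. clan_point (Collect f))"
    unfolding clan_space_def
    \<comment> \<open>Continuity into a pullback is tested after composing with
      \<open>point_fun\<close>, which here gives the inclusion of \<open>K\<close>.\<close>
    by (rule continuous_map_pullback') (auto simp: K_def o_def)
  moreover have "(\<lambda>f. clan_point (Collect f)) ` K = topspace (clan_space B)"
  proof -
    have "clan_point p \<in> (\<lambda>f. clan_point (Collect f)) ` K" if "clan B p" for p
      using that by (intro image_eqI[of _ _ "\<lambda>a. a \<in> p"]) (auto simp: K_def)
    then show ?thesis
      by (auto simp: topspace_clan_space K_def)
  qed
  ultimately show ?thesis
    using image_compactin[of "top_of_set K" K "clan_space B" "\<lambda>f. clan_point (Collect f)"]
    by (simp add: compact_space_def)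
qed

lemma regular_openin_clopen: "openin X U \<Longrightarrow> closedin X U \<Longrightarrow> regular_openin X U"
  by (simp add: regular_openin_def closure_of_closedin interior_of_openin)

lemma regular_closedin_clopen: "openin X U \<Longrightarrow> closedin X U \<Longrightarrow> regular_closedin X U"
  by (simp add: regular_closedin_def closure_of_closedin interior_of_openin)

text \<open>Clopen sets are regular open, and the clopen base of the Cantor space pulls
  back.\<close>

lemma semiregular_clan_space: "semiregular_space (clan_space B)"
  unfolding semiregular_space_iff
proof (intro allI impI)
  fix U x assume U: "openin (clan_space B) U \<and> x \<in> U"
  then obtain W where "open W" and W: "U = point_fun -` W \<inter> topspace (clan_space B)"
    unfolding topspace_clan_space by (auto simp: clan_space_def openin_pullback_topology)
  then obtain V where V: "open V" "closed V" "point_fun x \<in> V" "V \<subseteq> W"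
    using clopen_base_fun_bool[of W "point_fun x"] U by blast
  then have "regular_openin (clan_space B) (point_fun -` V \<inter> topspace (clan_space B))"
    by (intro regular_openin_clopen openin_clan_space closedin_clan_space)
  then show "\<exists>V. regular_openin (clan_space B) V \<and> x \<in> V \<and> V \<subseteq> U"
    using U V(3,4) W by blast
qed

lemma clans_with_eq: "clans_with B a = point_fun -` {f. f a} \<inter> topspace (clan_space B)"
  by (auto simp: clans_with_def topspace_clan_space)

lemma openin_clans_with: "openin (clan_space B) (clans_with B a)"
  unfolding clans_with_eq by (rule openin_clan_space[OF open_coordinate])

lemma regular_closedin_clans_with: "regular_closedin (clan_space B) (clans_with B a)"
proof (rule regular_closedin_clopen[OF openin_clans_with])
  show "closedin (clan_space B) (clans_with B a)"
    unfolding clans_with_eq by (rule closedin_clan_space[OF closed_coordinate])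
qed

lemma t0_clan_space: "t0_space (clan_space B)"
  unfolding t0_space_def
proof (intro ballI impI)
  fix P Q assume "P \<in> topspace (clan_space B)" "Q \<in> topspace (clan_space B)" "P \<noteq> Q"
  then obtain p q where pq: "P = clan_point p" "Q = clan_point q" "clan B p" "clan B q" "p \<noteq> q"
    by (auto simp: topspace_clan_space)
  \<comment> \<open>Distinct clans differ in some element \<open>a\<close>, and the open set
    \<open>clans_with B a\<close> tells them apart.\<close>
  then obtain a where "a \<in> p \<longleftrightarrow> a \<notin> q" by blast
  then have "P \<in> clans_with B a \<longleftrightarrow> Q \<notin> clans_with B a"
    using pq by (auto simp: clans_with_def)
  then show "\<exists>U. openin (clan_space B) U \<and> (P \<notin> U) = (Q \<in> U)"
    by (intro exI[of _ "clans_with B a"]) (simp add: openin_clans_with)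
qed

section \<open>The embedding into the regular closed sets\<close>

text \<open>Order and contact are the two clan characterizations read as statements about sets of
  clans; join, bottom and unit come directly from the clauses of \<open>clan\<close>.\<close>

lemma embedding_clans_with:
  assumes B: "contact_join_semilattice B"
  shows "isomorphic_embedding (clans_with B) B (RC_structure (clan_space B))"
proof -
  have le: "le B a b \<longleftrightarrow> clans_with B a \<subseteq> clans_with B b"
    if "a \<in> elems B" "b \<in> elems B" for a b
    unfolding clan_le_iff[OF B that] by (auto simp: clans_with_def)
  \<comment> \<open>Injectivity follows from reflection of the order and antisymmetry.\<close>
  moreover have "inj_on (clans_with B) (elems B)"
    using le le_antisym[OF B] by (auto simp: inj_on_def)
  moreover have "contact B a b \<longleftrightarrow> clans_with B a \<inter> clans_with B b \<noteq> {}"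
    if "a \<in> elems B" "b \<in> elems B" for a b
    unfolding clan_contact_iff[OF B that] by (auto simp: clans_with_def)
  moreover have "clans_with B (join B a b) = clans_with B a \<union> clans_with B b"
    if "a \<in> elems B" "b \<in> elems B" for a b
    using that by (auto simp: clans_with_def clan_def)
  moreover have "clans_with B (bottom B) = {}" "clans_with B (unit B) = topspace (clan_space B)"
    by (auto simp: clans_with_def clan_def topspace_clan_space)
  ultimately show ?thesis
    by (auto simp: isomorphic_embedding_def RC_structure_def regular_closedin_clans_with)
qed

theorem mainTheorem2:
  fixes B :: "'b contact_structure"
  assumes "contact_join_semilattice B"
  shows "\<exists>(X :: 'b set set set topology) (h :: 'b \<Rightarrow> 'b set set set set).
           compact_space X \<and> semiregular_space X \<and> t0_space X \<and>
           isomorphic_embedding h B (RC_structure X)"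
  using embedding_clans_with[OF assms]
  by (intro exI conjI) (rule compact_clan_space semiregular_clan_space t0_clan_space | assumption)+

end
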